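(* Let $T:\mathbb{R}^n\rightrightarrows\mathbb{R}^n$ be a maximal monotone operator with $T^{-1}(0)\neq\emptyset$. Let $\{z^k\}$, $\{\tilde z^k\}$, $\{v^k\}$, $\{\lambda_k\}$ and $\{\alpha_k\}$ be infinite sequences generated by Algorithm 1 (defined in the context) applied to $T$, so that $v^k\ne0$ for all $k\ge 0$. Assume that $\alpha\in[0,1)$, $\overline\rho\in(0,2)$ and $\{\alpha_k\}$ satisfy, for some $\beta>0$, $$0\le\alpha_k\le\alpha_{k+1}\le\alpha<\beta<1\quad\text{for all }k\ge0,$$ and $$\overline\rho=\frac{2(\beta-1)^2}{2(\beta-1)^2+3\beta-1}.$$ Then $$\sum_{k=1}^\infty\|z^k-z^{k-1}\|^2<+\infty.$$ Consequently, if in addition $\inf_k\lambda_k>0$, then $\{z^k\}$ converges to a point $z^\infty$ with $0\in T(z^\infty)$; moreover, $\{\tilde z^k\}$ converges to the same point $z^\infty$ and $\{v^k\}$ converges to $0$.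
   Context: $\langle\cdot,\cdot\rangle$ and $\|\cdot\|$ are the Euclidean inner product and norm on $\mathbb{R}^n$. Algorithm 1 (relative-error inertial-relaxed hybrid proximal projection method for $0\in T(z)$). Choose $z^0=z^{-1}\in\mathbb{R}^n$, constants $0\le\alpha,\sigma<1$ and $0<\underline\rho<\overline\rho<2$. For $k=0,1,\dots$: (1) choose $\alpha_k\in[0,\alpha]$ and set $w^k=z^k+\alpha_k(z^k-z^{k-1})$; (2) find $(\tilde z^k,v^k)\in\mathbb{R}^n\times\mathbb{R}^n$ and $\lambda_k>0$ such that $v^k\in T(\tilde z^k)$ and $\|\lambda_kv^k+\tilde z^k-w^k\|^2\le\sigma^2\left(\|\tilde z^k-w^k\|^2+\|\lambda_kv^k\|^2\right)$; (3) if $v^k=0$, stop; otherwise choose $\rho_k\in[\underline\rho,\overline\rho]$ and set $z^{k+1}=w^k-\rho_k\dfrac{\langle w^k-\tilde z^k,v^k\rangle}{\|v^k\|^2}v^k$. *)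

theory Defs
  imports "HOL-Analysis.Analysis"
begin

definition monotone_operator :: "('a::real_inner \<Rightarrow> 'a set) \<Rightarrow> bool" where
  "monotone_operator T \<longleftrightarrow>
     (\<forall>x y. \<forall>u \<in> T x. \<forall>v \<in> T y. 0 \<le> inner (x - y) (u - v))"

definition maximal_monotone_operator :: "('a::real_inner \<Rightarrow> 'a set) \<Rightarrow> bool" where
  "maximal_monotone_operator T \<longleftrightarrow>
     monotone_operator T \<and>
     (\<forall>S. monotone_operator S \<longrightarrow> (\<forall>x. T x \<subseteq> S x) \<longrightarrow> S = T)"

text \<open>\<open>prev_iterate z k\<close> is \<open>z\<^sup>k\<^sup>-\<^sup>1\<close>; its value at \<open>0\<close> encodes the initialisation
  \<open>z\<^sup>-\<^sup>1 = z\<^sup>0\<close>.\<close>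

definition prev_iterate :: "(nat \<Rightarrow> 'a) \<Rightarrow> nat \<Rightarrow> 'a" where
  "prev_iterate z k = (case k of 0 \<Rightarrow> z 0 | Suc j \<Rightarrow> z j)"

text \<open>Infinite runs of the relative-error inertial-relaxed hybrid proximal projection method
  for \<open>0 \<in> T z\<close>. The method stops as soon as \<open>v k = 0\<close>, so a run is infinite iff
  \<open>v k \<noteq> 0\<close> for all \<open>k\<close>. The constants \<open>\<alpha>\<close>, \<open>\<sigma>\<close>, \<open>\<rho>lo\<close>, \<open>\<rho>hi\<close> are fixed along the run;
  \<open>alphas\<close>, \<open>lam\<close> and \<open>rho\<close> are the parameters chosen at each iteration and \<open>zt\<close> is the
  sequence of approximate proximal points.\<close>

definition inertial_relaxed_hpp_run ::
  "('a::real_inner \<Rightarrow> 'a set) \<Rightarrow> real \<Rightarrow> real \<Rightarrow> real \<Rightarrow> real \<Rightarrow>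
   (nat \<Rightarrow> 'a) \<Rightarrow> (nat \<Rightarrow> 'a) \<Rightarrow> (nat \<Rightarrow> 'a) \<Rightarrow> (nat \<Rightarrow> 'a) \<Rightarrow>
   (nat \<Rightarrow> real) \<Rightarrow> (nat \<Rightarrow> real) \<Rightarrow> (nat \<Rightarrow> real) \<Rightarrow> bool" where
  "inertial_relaxed_hpp_run T \<alpha> \<sigma> \<rho>lo \<rho>hi z w zt v alphas lam rho \<longleftrightarrow>
     0 \<le> \<alpha> \<and> \<alpha> < 1 \<and> 0 \<le> \<sigma> \<and> \<sigma> < 1 \<and> 0 < \<rho>lo \<and> \<rho>lo < \<rho>hi \<and> \<rho>hi < 2 \<and>
     (\<forall>k. 0 \<le> alphas k \<and> alphas k \<le> \<alpha> \<and>
          w k = z k + alphas k *\<^sub>R (z k - prev_iterate z k) \<and>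
          0 < lam k \<and> v k \<in> T (zt k) \<and>
          (norm (lam k *\<^sub>R v k + zt k - w k))\<^sup>2
            \<le> \<sigma>\<^sup>2 * ((norm (zt k - w k))\<^sup>2 + (norm (lam k *\<^sub>R v k))\<^sup>2) \<and>
          v k \<noteq> 0 \<and>
          \<rho>lo \<le> rho k \<and> rho k \<le> \<rho>hi \<and>
          z (Suc k) = w k - (rho k * (inner (w k - zt k) (v k) / (norm (v k))\<^sup>2)) *\<^sub>R v k)"

end

theory Submission
  imports Defs
begin

text \<open>The error criterion says that \<open>v k\<close> points from \<open>zt k\<close> towards \<open>w k\<close>, so by monotonicity the
  hyperplane through \<open>zt k\<close> with normal \<open>v k\<close> separates \<open>w k\<close> from every zero \<open>x\<close> of \<open>T\<close>, and
  \<open>z (k+1)\<close> is a relaxed projection of \<open>w k\<close> onto the halfspace containing \<open>x\<close>. This yields the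
  Fejer inequality
  \<open>\<parallel>z (k+1) - x\<parallel>\<^sup>2 + \<tau> \<parallel>z (k+1) - w k\<parallel>\<^sup>2 \<le> \<parallel>w k - x\<parallel>\<^sup>2\<close> with \<open>\<tau> = 2 / \<rho>hi - 1\<close>
  (\<open>relaxed_projection_fejer\<close>).

  Since \<open>w k\<close> is an extrapolation of \<open>z (k-1)\<close> and \<open>z k\<close>, this becomes a second order recurrence
  for the numbers \<open>\<parallel>z k - x\<parallel>\<^sup>2\<close> and \<open>\<parallel>z k - z (k-1)\<parallel>\<^sup>2\<close>. A Lyapunov function for it
  decreases by a fixed multiple of \<open>\<parallel>z (k+1) - z k\<parallel>\<^sup>2\<close> as soon as
  \<open>\<alpha> (1 + \<alpha>) < \<tau> (1 - \<alpha>)\<^sup>2\<close>. The formula for \<open>\<rho>hi\<close> is chosen to make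
  \<open>\<beta> (1 + \<beta>) = \<tau> (1 - \<beta>)\<^sup>2\<close>, so that \<open>\<alpha> < \<beta>\<close> gives the strict inequality
  (\<open>relaxation_bound_gap\<close>). Hence the squared steps are summable and the distance of \<open>z k\<close> to each
  zero of \<open>T\<close> converges (\<open>inertial_recurrence\<close>).

  The error criterion also bounds \<open>\<lambda> k \<parallel>v k\<parallel>\<close> and \<open>\<parallel>zt k - w k\<parallel>\<close> by multiples of
  \<open>\<parallel>z (k+1) - w k\<parallel>\<close>, which tends to \<open>0\<close>. If the \<open>\<lambda> k\<close> are bounded away from \<open>0\<close>, then
  \<open>v k\<close> tends to \<open>0\<close> and \<open>zt k\<close> has the same cluster points as \<open>z k\<close>; these are zeros of \<open>T\<close>
  because the graph of a maximal monotone operator is closed. A bounded sequence in finite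
  dimension whose distances to its cluster points converge is convergent.\<close>

section \<open>Inertial recurrences\<close>

text \<open>The distance of \<open>x k\<close> to the fixed point \<open>L\<close> of \<open>t \<mapsto> a t + l\<close> is contracted by \<open>a\<close> at
  each step up to a small error \<open>e (1 - a)\<close>, so that its excess over \<open>e\<close> decays geometrically.\<close>

lemma tendsto_of_discounted_difference:
  fixes x :: "nat \<Rightarrow> real"
  assumes a: "0 \<le> a" "a < 1"
    and lim: "(\<lambda>k. x (Suc k) - a * x k) \<longlonglongrightarrow> l"
  shows "x \<longlonglongrightarrow> l / (1 - a)"
proof (rule LIMSEQ_I)
  fix r :: real assume r: "r > 0"
  define L where "L = l / (1 - a)"
  define e where "e = r / 2"
  have e: "e > 0" using r by (simp add: e_def)
  have "L * (1 - a) = l" using a by (simp add: L_def)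
  hence l: "l = L - a * L" by (simp add: algebra_simps)
  have "e * (1 - a) > 0" using e a by simp
  from LIMSEQ_D[OF lim this] obtain N where
    N: "\<And>k. k \<ge> N \<Longrightarrow> norm (x (Suc k) - a * x k - l) < e * (1 - a)" by blast
  have step: "\<bar>x (Suc k) - L\<bar> - e \<le> a * (\<bar>x k - L\<bar> - e)" if "k \<ge> N" for k
  proof -
    have "x (Suc k) - L = a * (x k - L) + (x (Suc k) - a * x k - l)"
      by (simp add: l algebra_simps)
    hence "\<bar>x (Suc k) - L\<bar> \<le> \<bar>a * (x k - L)\<bar> + \<bar>x (Suc k) - a * x k - l\<bar>"
      using abs_triangle_ineq by metis
    also have "\<dots> \<le> a * \<bar>x k - L\<bar> + e * (1 - a)"
      using N[OF that] a by (simp add: abs_mult)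
    finally show ?thesis by (simp add: algebra_simps)
  qed
  have geo: "\<bar>x (N + j) - L\<bar> - e \<le> a ^ j * (\<bar>x N - L\<bar> - e)" for j
  proof (induction j)
    case (Suc j)
    have "\<bar>x (N + Suc j) - L\<bar> - e \<le> a * (\<bar>x (N + j) - L\<bar> - e)"
      using step[of "N + j"] by simp
    also have "\<dots> \<le> a * (a ^ j * (\<bar>x N - L\<bar> - e))"
      using Suc a by (intro mult_left_mono)
    finally show ?case by simp
  qed simp
  have "(\<lambda>j. a ^ j * (\<bar>x N - L\<bar> - e)) \<longlonglongrightarrow> 0"
    using a by (auto intro!: tendsto_mult_left_zero LIMSEQ_power_zero)
  from LIMSEQ_D[OF this e] obtain M where
    M: "\<And>j. j \<ge> M \<Longrightarrow> \<bar>a ^ j * (\<bar>x N - L\<bar> - e)\<bar> < e" by auto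
  show "\<exists>no. \<forall>n\<ge>no. norm (x n - l / (1 - a)) < r"
  proof (intro exI allI impI)
    fix n assume n: "n \<ge> N + M"
    then obtain j where j: "n = N + j" "j \<ge> M"
      by (metis add.assoc le_Suc_ex le_add1)
    have "\<bar>x n - L\<bar> \<le> e + a ^ j * (\<bar>x N - L\<bar> - e)" using geo[of j] j by simp
    also have "\<dots> < r" using M[OF j(2)] r unfolding e_def by linarith
    finally show "norm (x n - l / (1 - a)) < r" by (simp add: L_def)
  qed
qed

text \<open>The recurrence is second order, so neither \<open>h\<close> nor \<open>d\<close> need decrease. The combination
  \<open>\<mu> k = h (k+1) - a k h k + \<delta> k d k\<close> does, where \<open>\<delta> k\<close> is the coefficient of \<open>d k\<close> in
  the recurrence: monotonicity of \<open>a\<close> gives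
  \<open>\<mu> (k+1) - \<mu> k \<le> - (\<tau> (1 - a k) - \<delta> (k+1)) d (k+1)\<close>, and the coefficient is at least
  \<open>\<tau> (1 - A)\<^sup>2 - A (1 + A)\<close>, which is positive by the hypothesis \<open>gap\<close>.
  Although \<open>\<mu>\<close> need not be nonnegative, \<open>\<mu> k \<le> \<mu> 0\<close> forces \<open>h\<close> to be bounded, as \<open>A < 1\<close>,
  and this bounds \<open>\<mu>\<close> below. Hence \<open>d\<close> is summable and \<open>\<mu>\<close>, thus \<open>h (k+1) - a k h k\<close>, converges;
  the limit of \<open>a\<close> is less than \<open>1\<close>, so \<open>h\<close> itself converges.\<close>

lemma inertial_recurrence:
  fixes h d a :: "nat \<Rightarrow> real" and \<tau> A :: real
  assumes h: "\<And>k. 0 \<le> h k" and d: "\<And>k. 0 \<le> d k"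
    and a: "\<And>k. 0 \<le> a k" "\<And>k. a k \<le> a (Suc k)" "\<And>k. a k \<le> A"
    and A: "A < 1" and \<tau>: "0 \<le> \<tau>"
    and gap: "A * (1 + A) < \<tau> * (1 - A)\<^sup>2"
    and rec: "\<And>k. h (Suc (Suc k)) - (1 + a k) * h (Suc k) + a k * h k
        \<le> (a k * (1 + a k) + \<tau> * a k * (1 - a k)) * d k - \<tau> * (1 - a k) * d (Suc k)"
  shows inertial_recurrence_summable: "summable d"
    and inertial_recurrence_convergent: "convergent h"
proof -
  define \<delta> where "\<delta> = (\<lambda>k. a k * (1 + a k) + \<tau> * a k * (1 - a k))"
  define \<mu> where "\<mu> = (\<lambda>k. h (Suc k) - a k * h k + \<delta> k * d k)"
  define c where "c = \<tau> * (1 - A)\<^sup>2 - A * (1 + A)"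
  have c: "c > 0" using gap by (simp add: c_def)
  have a1: "a k < 1" for k using a(3)[of k] A by simp
  have A0: "0 \<le> A" using a(1)[of 0] a(3)[of 0] by simp
  have \<delta>0: "0 \<le> \<delta> k" for k
    using a(1)[of k] a1[of k] \<tau> by (simp add: \<delta>_def)
  have coeff: "c \<le> \<tau> * (1 - a k) - \<delta> (Suc k)" for k
  proof -
    let ?b = "a (Suc k)"
    have "(1 - A)\<^sup>2 \<le> (1 - ?b)\<^sup>2" using a(3)[of "Suc k"] A by (intro power_mono) auto
    hence "\<tau> * (1 - A)\<^sup>2 \<le> \<tau> * (1 - ?b)\<^sup>2" using \<tau> by (rule mult_left_mono)
    moreover have "?b * (1 + ?b) \<le> A * (1 + A)"
      using a(1)[of "Suc k"] a(3)[of "Suc k"] by (intro mult_mono) auto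
    ultimately have "c \<le> \<tau> * (1 - ?b)\<^sup>2 - ?b * (1 + ?b)" by (simp add: c_def)
    also have "\<dots> = \<tau> * (1 - ?b) - \<delta> (Suc k)"
      by (simp add: \<delta>_def power2_eq_square algebra_simps)
    also have "\<dots> \<le> \<tau> * (1 - a k) - \<delta> (Suc k)"
      using a(2)[of k] \<tau> by (simp add: mult_left_mono)
    finally show ?thesis .
  qed
  have descent: "\<mu> (Suc k) + c * d (Suc k) \<le> \<mu> k" for k
  proof -
    have "a k * h (Suc k) \<le> a (Suc k) * h (Suc k)"
      using a(2) h by (intro mult_right_mono)
    moreover have "c * d (Suc k) \<le> (\<tau> * (1 - a k) - \<delta> (Suc k)) * d (Suc k)"
      using coeff d by (intro mult_right_mono)
    ultimately show ?thesis
      using rec[of k] by (simp add: \<mu>_def \<delta>_def algebra_simps)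
  qed
  have sum_le: "\<mu> k + c * (\<Sum>i<k. d (Suc i)) \<le> \<mu> 0" for k
  proof (induction k)
    case (Suc k)
    then show ?case using descent[of k] by (simp add: algebra_simps)
  qed simp
  have dec: "\<mu> k \<le> \<mu> 0" for k
    using sum_le[of k] c d by (smt (verit) mult_nonneg_nonneg sum_nonneg)
  define B where "B = h 0 + \<bar>\<mu> 0\<bar> / (1 - A)"
  have B0: "0 \<le> B" using h[of 0] A by (simp add: B_def)
  have hB: "h k \<le> B" for k
  proof (induction k)
    case 0
    then show ?case using A by (simp add: B_def)
  next
    case (Suc k)
    have "h (Suc k) \<le> a k * h k + \<mu> 0"
      using dec[of k] \<delta>0[of k] d[of k] mult_nonneg_nonneg[of "\<delta> k" "d k"]
      unfolding \<mu>_def by linarith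
    also have "a k * h k \<le> A * B"
      using Suc a A0 h by (intro mult_mono) auto
    also have "A * B + \<mu> 0 \<le> B"
    proof -
      have "(1 - A) * B = (1 - A) * h 0 + \<bar>\<mu> 0\<bar>" using A by (simp add: B_def field_simps)
      moreover have "0 \<le> (1 - A) * h 0" using A h[of 0] by simp
      ultimately show ?thesis by (simp add: algebra_simps)
    qed
    finally show ?case by simp
  qed
  have \<mu>_lower: "- B \<le> \<mu> k" for k
  proof -
    have "a k * h k \<le> 1 * B" using a1[of k] a(1) hB h by (intro mult_mono) (auto intro: less_imp_le)
    thus ?thesis
      using h[of "Suc k"] mult_nonneg_nonneg[OF \<delta>0[of k] d[of k]] unfolding \<mu>_def by linarith
  qed
  have "(\<Sum>i<k. d (Suc i)) \<le> (\<mu> 0 + B) / c" for k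
    using sum_le[of k] \<mu>_lower[of k] c by (simp add: pos_le_divide_eq mult.commute)
  hence "summable (\<lambda>k. d (Suc k))"
    using d by (intro summableI_nonneg_bounded) auto
  thus sd: "summable d" by (simp add: summable_Suc_iff)

  have "decseq \<mu>"
  proof (rule decseq_SucI)
    fix k
    show "\<mu> (Suc k) \<le> \<mu> k" using descent[of k] c d[of "Suc k"] by (smt (verit) mult_nonneg_nonneg)
  qed
  then obtain l where l: "\<mu> \<longlonglongrightarrow> l"
    using decseq_convergent \<mu>_lower by metis
  have "incseq a" using a(2) by (rule incseq_SucI)
  then obtain a' where a': "a \<longlonglongrightarrow> a'"
    using incseq_convergent a(3) by metis
  have a'01: "0 \<le> a'" "a' < 1"
    using LIMSEQ_le_const[OF a', of 0] LIMSEQ_le_const2[OF a', of A] a A by force+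
  have d0: "d \<longlonglongrightarrow> 0" using sd by (rule summable_LIMSEQ_zero)
  have "(\<lambda>k. \<delta> k * d k) \<longlonglongrightarrow> (a' * (1 + a') + \<tau> * a' * (1 - a')) * 0"
    unfolding \<delta>_def by (intro tendsto_intros a' d0)
  moreover have "(\<lambda>k. (a k - a') * h k) \<longlonglongrightarrow> 0"
  proof (rule Lim_null_comparison)
    show "\<forall>\<^sub>F k in sequentially. norm ((a k - a') * h k) \<le> \<bar>a k - a'\<bar> * B"
      using hB h by (intro always_eventually) (auto intro!: mult_left_mono simp: abs_mult)
    show "(\<lambda>k. \<bar>a k - a'\<bar> * B) \<longlonglongrightarrow> 0"
      using tendsto_mult[OF tendsto_rabs[OF LIM_zero[OF a']] tendsto_const[of B]] by simp
  qed
  ultimately have "(\<lambda>k. \<mu> k - \<delta> k * d k + (a k - a') * h k)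
      \<longlonglongrightarrow> l - (a' * (1 + a') + \<tau> * a' * (1 - a')) * 0 + 0"
    by (intro tendsto_add tendsto_diff l)
  moreover have "\<mu> k - \<delta> k * d k + (a k - a') * h k = h (Suc k) - a' * h k" for k
    by (simp add: \<mu>_def algebra_simps)
  ultimately have "(\<lambda>k. h (Suc k) - a' * h k) \<longlonglongrightarrow> l" by simp
  from tendsto_of_discounted_difference[OF a'01 this] show "convergent h"
    by (rule convergentI)
qed

section \<open>One step of the method\<close>

text \<open>Expanding the square on the left turns the error criterion into a quantitative separation:
  for \<open>s < 1\<close> the point \<open>w\<close> lies well on the positive side of the hyperplane through \<open>y\<close> with
  normal \<open>v\<close>.\<close>

lemma relative_error_inner_lower_bound:
  fixes v w y :: "'a::real_inner"
  assumes "(norm (l *\<^sub>R v + y - w))\<^sup>2 \<le> s * ((norm (y - w))\<^sup>2 + (norm (l *\<^sub>R v))\<^sup>2)"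
  shows "(1 - s) * ((norm (y - w))\<^sup>2 + (norm (l *\<^sub>R v))\<^sup>2) \<le> 2 * l * inner (w - y) v"
proof -
  have "(norm (l *\<^sub>R v + y - w))\<^sup>2
      = (norm (y - w))\<^sup>2 + (norm (l *\<^sub>R v))\<^sup>2 - 2 * l * inner (w - y) v"
    unfolding power2_norm_eq_inner
    by (simp add: inner_add_left inner_add_right inner_diff_left inner_diff_right
        inner_commute algebra_simps power2_eq_square)
  with assms show ?thesis by (simp add: algebra_simps)
qed

text \<open>The point \<open>z'\<close> is a relaxed projection of \<open>w\<close> onto the halfspace
  \<open>{p. \<langle>p - y, v\<rangle> \<le> 0}\<close>, which contains \<open>x\<close>. For the factor \<open>r\<close> itself the gain
  is \<open>(2 / r - 1) \<parallel>z' - w\<parallel>\<^sup>2\<close>; the uniform bound \<open>R\<close> can only make it smaller.\<close>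

lemma relaxed_projection_fejer:
  fixes v w x y z' :: "'a::real_inner"
  assumes x: "0 \<le> inner (y - x) v" and w: "0 \<le> inner (w - y) v" and v: "v \<noteq> 0"
    and r: "0 < r" "r \<le> R"
    and z': "z' = w - (r * (inner (w - y) v / (norm v)\<^sup>2)) *\<^sub>R v"
  shows "(norm (z' - x))\<^sup>2 + (2 / R - 1) * (norm (z' - w))\<^sup>2 \<le> (norm (w - x))\<^sup>2"
proof -
  define g where "g = inner (w - y) v / (norm v)\<^sup>2"
  define t where "t = r * g"
  have g: "0 \<le> g" "inner (w - y) v = g * (norm v)\<^sup>2" using w v by (auto simp: g_def)
  have z'': "z' = w - t *\<^sub>R v" by (simp add: z' t_def g_def)
  have eq1: "(norm (z' - x))\<^sup>2 = (norm (w - x))\<^sup>2 - 2 * t * inner (w - x) v + t\<^sup>2 * (norm v)\<^sup>2"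
    unfolding z'' power2_norm_eq_inner
    by (simp add: inner_add_left inner_add_right inner_diff_left inner_diff_right
        inner_commute algebra_simps power2_eq_square)
  have eq2: "(norm (z' - w))\<^sup>2 = t\<^sup>2 * (norm v)\<^sup>2" by (simp add: z'' power_mult_distrib)
  have "g * (norm v)\<^sup>2 \<le> inner (w - x) v"
    using x g(2) by (simp add: inner_diff_left)
  hence "2 * t * (g * (norm v)\<^sup>2) \<le> 2 * t * inner (w - x) v"
    using g(1) r by (intro mult_left_mono) (auto simp: t_def)
  moreover have "2 * t * (g * (norm v)\<^sup>2) = 2 / r * (t\<^sup>2 * (norm v)\<^sup>2)"
    using r by (simp add: t_def power2_eq_square)
  moreover have "2 / R * (t\<^sup>2 * (norm v)\<^sup>2) \<le> 2 / r * (t\<^sup>2 * (norm v)\<^sup>2)"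
    using r by (intro mult_right_mono divide_left_mono) auto
  ultimately show ?thesis unfolding eq1 eq2 by (simp add: algebra_simps)
qed

text \<open>With \<open>p = \<parallel>y - w\<parallel>\<close> and \<open>q = l \<parallel>v\<parallel>\<close> the separation bounds the length of the step below
  by a multiple of \<open>(p\<^sup>2 + q\<^sup>2) / q\<close>. This is at least \<open>q\<close>, and at least \<open>2 p\<close> by the
  inequality of arithmetic and geometric means.\<close>

lemma relaxed_projection_step_length:
  fixes v w y z' :: "'a::real_inner"
  assumes crit: "(norm (l *\<^sub>R v + y - w))\<^sup>2 \<le> s * ((norm (y - w))\<^sup>2 + (norm (l *\<^sub>R v))\<^sup>2)"
    and s: "s \<le> 1" and l: "0 < l" and v: "v \<noteq> 0" and r: "0 \<le> r0" "r0 \<le> r"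
    and z': "z' = w - (r * (inner (w - y) v / (norm v)\<^sup>2)) *\<^sub>R v"
  shows "r0 * (1 - s) * (l * norm v) \<le> 2 * norm (z' - w)"
    and "r0 * (1 - s) * norm (y - w) \<le> norm (z' - w)"
proof -
  define p where "p = norm (y - w)"
  define q where "q = l * norm v"
  define I where "I = inner (w - y) v"
  have q: "q > 0" using l v by (simp add: q_def)
  have low: "(1 - s) * (p\<^sup>2 + q\<^sup>2) \<le> 2 * l * I"
    using relative_error_inner_lower_bound[OF crit] l by (simp add: p_def q_def I_def)
  have "0 \<le> (1 - s) * (p\<^sup>2 + q\<^sup>2)" using s by simp
  with low have "0 \<le> 2 * l * I" by linarith
  hence I: "0 \<le> I" using l by (simp add: zero_le_mult_iff)
  have "norm (z' - w) = r * (I / (norm v)\<^sup>2) * norm v"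
    using r I by (simp add: z' I_def)
  also have "\<dots> = r * (l * I) / q"
    using v l by (simp add: q_def power2_eq_square)
  finally have len: "norm (z' - w) * q = r * (l * I)" using q by simp
  have "r0 * ((1 - s) * (p\<^sup>2 + q\<^sup>2)) \<le> r * (2 * l * I)"
    using r low \<open>0 \<le> 2 * l * I\<close> s by (intro mult_mono[OF r(2) low]) auto
  hence main: "r0 * (1 - s) * (p\<^sup>2 + q\<^sup>2) \<le> 2 * norm (z' - w) * q"
    using len by (simp add: algebra_simps)
  have k: "0 \<le> r0 * (1 - s)" using r s by simp
  have "r0 * (1 - s) * q\<^sup>2 \<le> r0 * (1 - s) * (p\<^sup>2 + q\<^sup>2)"
    using k by (intro mult_left_mono) auto
  with main have "(r0 * (1 - s) * q) * q \<le> (2 * norm (z' - w)) * q"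
    by (simp add: power2_eq_square algebra_simps)
  with q show "r0 * (1 - s) * (l * norm v) \<le> 2 * norm (z' - w)"
    by (simp add: q_def[symmetric])
  have "2 * p * q \<le> p\<^sup>2 + q\<^sup>2" by (rule sum_squares_bound)
  hence "r0 * (1 - s) * (2 * p * q) \<le> r0 * (1 - s) * (p\<^sup>2 + q\<^sup>2)"
    using k by (intro mult_left_mono) auto
  with main have "(r0 * (1 - s) * p) * q \<le> norm (z' - w) * q" by (simp add: algebra_simps)
  with q show "r0 * (1 - s) * norm (y - w) \<le> norm (z' - w)"
    by (simp add: p_def[symmetric])
qed

lemma extrapolation_dist_sq:
  fixes x z z0 :: "'a::real_inner"
  shows "(norm (z + a *\<^sub>R (z - z0) - x))\<^sup>2
    = (1 + a) * (norm (z - x))\<^sup>2 - a * (norm (z0 - x))\<^sup>2 + a * (1 + a) * (norm (z - z0))\<^sup>2"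
  unfolding power2_norm_eq_inner
  by (simp add: inner_add_left inner_add_right inner_diff_left inner_diff_right
      inner_commute algebra_simps)

text \<open>The two sides differ by \<open>a \<parallel>(z' - z) - (z - z0)\<parallel>\<^sup>2\<close>.\<close>

lemma extrapolation_residual_lower_bound:
  fixes z z0 z' :: "'a::real_inner"
  assumes "0 \<le> a"
  shows "(1 - a) * (norm (z' - z))\<^sup>2 - a * (1 - a) * (norm (z - z0))\<^sup>2
    \<le> (norm (z' - (z + a *\<^sub>R (z - z0))))\<^sup>2"
proof -
  have "(norm (z' - (z + a *\<^sub>R (z - z0))))\<^sup>2
      - ((1 - a) * (norm (z' - z))\<^sup>2 - a * (1 - a) * (norm (z - z0))\<^sup>2)
      = a * (norm ((z' - z) - (z - z0)))\<^sup>2"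
    unfolding power2_norm_eq_inner
  by (simp add: inner_add_left inner_add_right inner_diff_left inner_diff_right
      inner_commute algebra_simps)
  moreover have "0 \<le> a * (norm ((z' - z) - (z - z0)))\<^sup>2" using assms by simp
  ultimately show ?thesis by linarith
qed

section \<open>Maximal monotone operators\<close>

text \<open>Otherwise adding the pair \<open>(x, u)\<close> to the graph would give a proper monotone extension.\<close>

lemma maximal_monotone_memI:
  assumes T: "maximal_monotone_operator T"
    and rel: "\<And>y w. w \<in> T y \<Longrightarrow> 0 \<le> inner (x - y) (u - w)"
  shows "u \<in> T x"
proof -
  let ?S = "T(x := insert u (T x))"
  have mono: "0 \<le> inner (a - b) (p - q)" if "p \<in> T a" "q \<in> T b" for a b p q
    using T that unfolding maximal_monotone_operator_def monotone_operator_def by blast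
  have rel': "0 \<le> inner (y - x) (w - u)" if "w \<in> T y" for y w
  proof -
    have "inner (y - x) (w - u) = inner (x - y) (u - w)"
      by (simp add: inner_diff_left inner_diff_right)
    with rel[OF that] show ?thesis by simp
  qed
  have "monotone_operator ?S"
    unfolding monotone_operator_def
  proof (intro allI ballI)
    fix a b p q assume "p \<in> ?S a" "q \<in> ?S b"
    then consider "p \<in> T a" "q \<in> T b" | "a = x" "p = u" "q \<in> T b"
      | "p \<in> T a" "b = x" "q = u" | "a = b" "p = q"
      by (auto split: if_splits)
    then show "0 \<le> inner (a - b) (p - q)"
      by cases (simp_all add: mono rel rel')
  qed
  moreover have "\<forall>y. T y \<subseteq> ?S y" by auto
  ultimately have "?S = T" using T unfolding maximal_monotone_operator_def by blast
  hence "?S x = T x" by (rule fun_cong)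
  thus ?thesis by auto
qed

lemma maximal_monotone_closed_graph:
  fixes T :: "'a::real_inner \<Rightarrow> 'a set"
  assumes T: "maximal_monotone_operator T" and mem: "\<And>k. v k \<in> T (y k)"
    and y: "y \<longlonglongrightarrow> x" and v: "v \<longlonglongrightarrow> u"
  shows "u \<in> T x"
proof (rule maximal_monotone_memI[OF T])
  fix p q assume q: "q \<in> T p"
  have "(\<lambda>k. inner (y k - p) (v k - q)) \<longlonglongrightarrow> inner (x - p) (u - q)"
    by (intro tendsto_intros y v)
  moreover have "0 \<le> inner (y k - p) (v k - q)" for k
    using T mem q unfolding maximal_monotone_operator_def monotone_operator_def by blast
  ultimately show "0 \<le> inner (x - p) (u - q)"
    using LIMSEQ_le_const by blast
qed

text \<open>The finite-dimensional form of Opial's lemma: by compactness there is a cluster point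
  \<open>x\<close>, which lies in \<open>S\<close>, and the convergent distance to it vanishes along a subsequence.\<close>

lemma convergent_of_convergent_dist_to_cluster_points:
  fixes z :: "nat \<Rightarrow> 'a::heine_borel"
  assumes S: "S \<noteq> {}" and conv: "\<And>x. x \<in> S \<Longrightarrow> convergent (\<lambda>k. dist (z k) x)"
    and cluster: "\<And>x r. strict_mono r \<Longrightarrow> (z \<circ> r) \<longlonglongrightarrow> x \<Longrightarrow> x \<in> S"
  shows "\<exists>x\<in>S. z \<longlonglongrightarrow> x"
proof -
  obtain x0 where x0: "x0 \<in> S" using S by blast
  have "Bseq (\<lambda>k. dist (z k) x0)" using conv[OF x0] by (rule convergent_imp_Bseq)
  then obtain K where K: "\<And>k. norm (dist (z k) x0) \<le> K" by (rule BseqE) blast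
  have "bounded (range z)"
    unfolding bounded_any_center[where a = x0]
  proof (intro exI ballI)
    fix y assume "y \<in> range z"
    then show "dist x0 y \<le> K" using K by (auto simp: dist_commute)
  qed
  then obtain x r where r: "strict_mono r" and x: "(z \<circ> r) \<longlonglongrightarrow> x"
    using bounded_imp_convergent_subsequence by blast
  have "x \<in> S" using cluster r x .
  then obtain L where L: "(\<lambda>k. dist (z k) x) \<longlonglongrightarrow> L"
    using conv[of x] by (auto simp: convergent_def)
  have "(\<lambda>k. dist (z (r k)) x) \<longlonglongrightarrow> L"
    using LIMSEQ_subseq_LIMSEQ[OF L r] by (simp add: o_def)
  moreover have "(\<lambda>k. dist (z (r k)) x) \<longlonglongrightarrow> 0"
    using x tendsto_dist_iff[of "z \<circ> r"] by (simp add: o_def)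
  ultimately have "L = 0" by (rule LIMSEQ_unique)
  with L have "z \<longlonglongrightarrow> x" using tendsto_dist_iff[of z] by simp
  with \<open>x \<in> S\<close> show ?thesis by blast
qed

section \<open>Convergence of the method\<close>

text \<open>Put \<open>\<tau> = 2 / R - 1\<close>. The formula for \<open>R\<close> amounts to \<open>\<tau> (1 - \<beta>)\<^sup>2 = \<beta> (1 + \<beta>)\<close>, and passing from
  \<open>\<beta>\<close> to the smaller \<open>\<alpha>\<close> increases the left side and strictly decreases the right side.\<close>

lemma relaxation_bound_gap:
  fixes \<alpha> \<beta> R :: real
  assumes \<alpha>: "0 \<le> \<alpha>" "\<alpha> < \<beta>" and \<beta>: "\<beta> < 1" and R: "0 < R"
    and R_eq: "R = 2 * (\<beta> - 1)\<^sup>2 / (2 * (\<beta> - 1)\<^sup>2 + 3 * \<beta> - 1)"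
  shows "0 \<le> 2 / R - 1" and "\<alpha> * (1 + \<alpha>) < (2 / R - 1) * (1 - \<alpha>)\<^sup>2"
proof -
  define \<tau> where "\<tau> = 2 / R - 1"
  have sq: "0 < (1 - \<beta>)\<^sup>2" using \<beta> by simp
  have "2 / R = (2 * (\<beta> - 1)\<^sup>2 + 3 * \<beta> - 1) / (\<beta> - 1)\<^sup>2"
    unfolding R_eq divide_divide_eq_right using sq
    by (simp add: power2_commute[of \<beta>] divide_simps)
  hence "2 / R * (1 - \<beta>)\<^sup>2 = 2 * (1 - \<beta>)\<^sup>2 + 3 * \<beta> - 1"
    using sq by (simp add: power2_commute[of \<beta>])
  hence \<tau>: "\<tau> * (1 - \<beta>)\<^sup>2 = \<beta> * (1 + \<beta>)"
    by (simp add: \<tau>_def algebra_simps power2_eq_square)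
  hence "0 \<le> \<tau> * (1 - \<beta>)\<^sup>2" using \<alpha> by simp
  thus \<tau>0: "0 \<le> 2 / R - 1" using sq by (simp add: zero_le_mult_iff \<tau>_def)
  have "\<alpha> * (1 + \<alpha>) < \<beta> * (1 + \<beta>)"
    using \<alpha> by (intro mult_strict_mono) auto
  also have "\<dots> \<le> \<tau> * (1 - \<alpha>)\<^sup>2"
    unfolding \<tau>[symmetric] using \<tau>0 \<alpha> \<beta> by (intro mult_left_mono power_mono) (auto simp: \<tau>_def)
  finally show "\<alpha> * (1 + \<alpha>) < (2 / R - 1) * (1 - \<alpha>)\<^sup>2" by (simp add: \<tau>_def)
qed

lemma inertial_relaxed_hpp_run_stepD:
  assumes "inertial_relaxed_hpp_run T \<alpha> \<sigma> \<rho>lo \<rho>hi z w zt v alphas lam rho"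
  shows "0 \<le> alphas k" "alphas k \<le> \<alpha>"
    and "w k = z k + alphas k *\<^sub>R (z k - prev_iterate z k)"
    and "0 < lam k" "v k \<in> T (zt k)"
    and "(norm (lam k *\<^sub>R v k + zt k - w k))\<^sup>2
            \<le> \<sigma>\<^sup>2 * ((norm (zt k - w k))\<^sup>2 + (norm (lam k *\<^sub>R v k))\<^sup>2)"
    and "v k \<noteq> 0" "\<rho>lo \<le> rho k" "rho k \<le> \<rho>hi"
    and "z (Suc k) = w k - (rho k * (inner (w k - zt k) (v k) / (norm (v k))\<^sup>2)) *\<^sub>R v k"
  using assms unfolding inertial_relaxed_hpp_run_def by blast+

lemma inertial_relaxed_hpp_run_constD:
  assumes "inertial_relaxed_hpp_run T \<alpha> \<sigma> \<rho>lo \<rho>hi z w zt v alphas lam rho"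
  shows "0 \<le> \<alpha>" "\<alpha> < 1" "0 < \<rho>lo" "0 < \<rho>hi" "\<sigma>\<^sup>2 < 1"
proof -
  have c: "0 \<le> \<alpha>" "\<alpha> < 1" "0 \<le> \<sigma>" "\<sigma> < 1" "0 < \<rho>lo" "\<rho>lo < \<rho>hi"
    using assms unfolding inertial_relaxed_hpp_run_def by blast+
  thus "0 \<le> \<alpha>" "\<alpha> < 1" "0 < \<rho>lo" "0 < \<rho>hi" by simp_all
  from c show "\<sigma>\<^sup>2 < 1" by (simp add: abs_square_less_1)
qed

text \<open>Inserting the extrapolation formulas for \<open>w k\<close> into the Fejer inequality gives the
  recurrence of \<open>inertial_recurrence\<close>.\<close>

lemma inertial_relaxed_hpp_run_recurrence:
  assumes run: "inertial_relaxed_hpp_run T \<alpha> \<sigma> \<rho>lo \<rho>hi z w zt v alphas lam rho"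
    and T: "monotone_operator T" and x: "0 \<in> T x" and \<tau>: "0 \<le> 2 / \<rho>hi - 1"
  defines "\<tau> \<equiv> 2 / \<rho>hi - 1"
  shows "(norm (z (Suc k) - x))\<^sup>2 - (1 + alphas k) * (norm (z k - x))\<^sup>2
        + alphas k * (norm (prev_iterate z k - x))\<^sup>2
      \<le> (alphas k * (1 + alphas k) + \<tau> * alphas k * (1 - alphas k)) * (norm (z k - prev_iterate z k))\<^sup>2
        - \<tau> * (1 - alphas k) * (norm (z (Suc k) - z k))\<^sup>2"
proof -
  note step = inertial_relaxed_hpp_run_stepD[OF run, of k]
  note const = inertial_relaxed_hpp_run_constD[OF run]
  have "0 \<le> (1 - \<sigma>\<^sup>2) * ((norm (zt k - w k))\<^sup>2 + (norm (lam k *\<^sub>R v k))\<^sup>2)"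
    using const by simp
  with relative_error_inner_lower_bound[OF step(6)]
  have "0 \<le> 2 * lam k * inner (w k - zt k) (v k)" by linarith
  hence w: "0 \<le> inner (w k - zt k) (v k)" using step(4) by (simp add: zero_le_mult_iff)
  have "0 \<le> inner (zt k - x) (v k - 0)"
    using T step(5) x unfolding monotone_operator_def by blast
  hence "(norm (z (Suc k) - x))\<^sup>2 + \<tau> * (norm (z (Suc k) - w k))\<^sup>2 \<le> (norm (w k - x))\<^sup>2"
    unfolding \<tau>_def using step const w by (intro relaxed_projection_fejer) auto
  moreover have "\<tau> * ((1 - alphas k) * (norm (z (Suc k) - z k))\<^sup>2
        - alphas k * (1 - alphas k) * (norm (z k - prev_iterate z k))\<^sup>2)
      \<le> \<tau> * (norm (z (Suc k) - w k))\<^sup>2"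
    unfolding step(3) using \<tau> step(1)
    by (intro mult_left_mono extrapolation_residual_lower_bound) (auto simp: \<tau>_def)
  moreover have "(norm (w k - x))\<^sup>2 = (1 + alphas k) * (norm (z k - x))\<^sup>2
      - alphas k * (norm (prev_iterate z k - x))\<^sup>2
      + alphas k * (1 + alphas k) * (norm (z k - prev_iterate z k))\<^sup>2"
    unfolding step(3) by (rule extrapolation_dist_sq)
  ultimately show ?thesis by (simp add: algebra_simps)
qed

lemma inertial_relaxed_hpp_run_residuals_tendsto_0:
  assumes run: "inertial_relaxed_hpp_run T \<alpha> \<sigma> \<rho>lo \<rho>hi z w zt v alphas lam rho"
    and steps: "(\<lambda>k. z (Suc k) - z k) \<longlonglongrightarrow> 0"
    and lam: "0 < c" "\<And>k. c \<le> lam k"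
  shows "v \<longlonglongrightarrow> 0" and "(\<lambda>k. zt k - z k) \<longlonglongrightarrow> 0"
proof -
  note step = inertial_relaxed_hpp_run_stepD[OF run]
  note const = inertial_relaxed_hpp_run_constD[OF run]
  have "(\<lambda>k. z (Suc k) - prev_iterate z (Suc k)) \<longlonglongrightarrow> 0"
    using steps by (simp add: prev_iterate_def)
  hence prev: "(\<lambda>k. z k - prev_iterate z k) \<longlonglongrightarrow> 0" by (rule LIMSEQ_imp_Suc)
  have wz: "(\<lambda>k. w k - z k) \<longlonglongrightarrow> 0"
  proof (rule Lim_null_comparison)
    have "norm (w k - z k) \<le> norm (z k - prev_iterate z k)" for k
      using step(1,2)[of k] const(2) unfolding step(3)
      by (simp add: mult_left_le_one_le)
    thus "\<forall>\<^sub>F k in sequentially. norm (w k - z k) \<le> norm (z k - prev_iterate z k)" by simp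
    show "(\<lambda>k. norm (z k - prev_iterate z k)) \<longlonglongrightarrow> 0" using prev by (rule tendsto_norm_zero)
  qed
  have zw: "(\<lambda>k. z (Suc k) - w k) \<longlonglongrightarrow> 0" using tendsto_diff[OF steps wz] by simp
  define K where "K = \<rho>lo * (1 - \<sigma>\<^sup>2)"
  have K: "0 < K" using const by (simp add: K_def)
  have bounds: "K * (lam k * norm (v k)) \<le> 2 * norm (z (Suc k) - w k)"
      "K * norm (zt k - w k) \<le> norm (z (Suc k) - w k)" for k
    unfolding K_def
    by (rule relaxed_projection_step_length[OF step(6) less_imp_le[OF const(5)] step(4,7)
          less_imp_le[OF const(3)] step(8,10)])+
  show "v \<longlonglongrightarrow> 0"
  proof (rule Lim_null_comparison)
    have "norm (v k) \<le> 2 / (K * c) * norm (z (Suc k) - w k)" for k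
    proof -
      have "K * (c * norm (v k)) \<le> K * (lam k * norm (v k))"
        using K lam by (intro mult_left_mono mult_right_mono) auto
      with bounds(1)[of k] have "K * c * norm (v k) \<le> 2 * norm (z (Suc k) - w k)" by simp
      thus ?thesis using K lam by (simp add: field_simps)
    qed
    thus "\<forall>\<^sub>F k in sequentially. norm (v k) \<le> 2 / (K * c) * norm (z (Suc k) - w k)" by simp
    show "(\<lambda>k. 2 / (K * c) * norm (z (Suc k) - w k)) \<longlonglongrightarrow> 0"
      by (intro tendsto_mult_right_zero tendsto_norm_zero zw)
  qed
  have "(\<lambda>k. zt k - w k) \<longlonglongrightarrow> 0"
  proof (rule Lim_null_comparison)
    show "\<forall>\<^sub>F k in sequentially. norm (zt k - w k) \<le> 1 / K * norm (z (Suc k) - w k)"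
      using bounds(2) K by (simp add: field_simps)
    show "(\<lambda>k. 1 / K * norm (z (Suc k) - w k)) \<longlonglongrightarrow> 0"
      by (intro tendsto_mult_right_zero tendsto_norm_zero zw)
  qed
  from tendsto_add[OF this wz] show "(\<lambda>k. zt k - z k) \<longlonglongrightarrow> 0" by simp
qed

theorem theorem2p5:
  fixes T :: "real ^ 'n \<Rightarrow> (real ^ 'n) set"
    and z w zt v :: "nat \<Rightarrow> real ^ 'n"
    and alphas lam rho :: "nat \<Rightarrow> real"
    and \<alpha> \<beta> \<sigma> \<rho>lo \<rho>hi :: real
  assumes "maximal_monotone_operator T"
    and "{x. 0 \<in> T x} \<noteq> {}"
    and "inertial_relaxed_hpp_run T \<alpha> \<sigma> \<rho>lo \<rho>hi z w zt v alphas lam rho"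
    and "0 < \<beta>"
    and "\<And>k. 0 \<le> alphas k \<and> alphas k \<le> alphas (Suc k) \<and> alphas (Suc k) \<le> \<alpha>"
    and "\<alpha> < \<beta>" and "\<beta> < 1"
    and "\<rho>hi = 2 * (\<beta> - 1)\<^sup>2 / (2 * (\<beta> - 1)\<^sup>2 + 3 * \<beta> - 1)"
  shows "summable (\<lambda>k. (norm (z (Suc k) - z k))\<^sup>2) \<and>
    (0 < (INF k. lam k) \<longrightarrow>
      (\<exists>zinf. 0 \<in> T zinf \<and> z \<longlonglongrightarrow> zinf \<and> zt \<longlonglongrightarrow> zinf \<and> v \<longlonglongrightarrow> 0))"
proof -
  note run = assms(3)
  note step = inertial_relaxed_hpp_run_stepD[OF run]
  note const = inertial_relaxed_hpp_run_constD[OF run]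
  note gap = relaxation_bound_gap[OF const(1) assms(6,7) const(4) assms(8)]
  have mono: "monotone_operator T" using assms(1) by (simp add: maximal_monotone_operator_def)
  define d where "d = (\<lambda>k. (norm (z k - prev_iterate z k))\<^sup>2)"
  \<comment> \<open>Shifted by one, so that the distances at the times \<open>-1, 0, 1, \<dots>\<close> form one sequence.\<close>
  define h where "h = (\<lambda>x k. (norm (prev_iterate z k - x))\<^sup>2)"
  have prev_Suc: "prev_iterate z (Suc k) = z k" for k by (simp add: prev_iterate_def)
  have rec: "h x (Suc (Suc k)) - (1 + alphas k) * h x (Suc k) + alphas k * h x k
      \<le> (alphas k * (1 + alphas k) + (2 / \<rho>hi - 1) * alphas k * (1 - alphas k)) * d k
        - (2 / \<rho>hi - 1) * (1 - alphas k) * d (Suc k)" if "0 \<in> T x" for x k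
    using inertial_relaxed_hpp_run_recurrence[OF run mono that gap(1), of k]
    unfolding h_def d_def prev_Suc .
  have nonneg: "0 \<le> h x k" "0 \<le> d k" for x k by (simp_all add: h_def d_def)
  have incr: "alphas k \<le> alphas (Suc k)" for k using assms(5) by blast
  have conv: "summable d" "convergent (h x)" if "0 \<in> T x" for x
    by (rule inertial_recurrence[of "h x" d alphas \<alpha> "2 / \<rho>hi - 1",
          OF nonneg step(1) incr step(2) const(2) gap rec[OF that]])+
  obtain x0 where "0 \<in> T x0" using assms(2) by blast
  from conv(1)[OF this] have "summable (\<lambda>k. d (Suc k))" by (simp add: summable_Suc_iff)
  hence summ: "summable (\<lambda>k. (norm (z (Suc k) - z k))\<^sup>2)" by (simp add: d_def prev_Suc)
  moreover have "\<exists>zinf. 0 \<in> T zinf \<and> z \<longlonglongrightarrow> zinf \<and> zt \<longlonglongrightarrow> zinf \<and> v \<longlonglongrightarrow> 0"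
    if inf: "0 < (INF k. lam k)"
  proof -
    have "(\<lambda>k. (norm (z (Suc k) - z k))\<^sup>2) \<longlonglongrightarrow> 0" using summ by (rule summable_LIMSEQ_zero)
    hence steps: "(\<lambda>k. z (Suc k) - z k) \<longlonglongrightarrow> 0"
      by (simp add: tendsto_norm_zero_iff)
    have "bdd_below (range lam)" using step(4) by (auto intro!: bdd_belowI[of _ 0] less_imp_le)
    hence lam: "(INF k. lam k) \<le> lam k" for k by (intro cINF_lower) auto
    note res = inertial_relaxed_hpp_run_residuals_tendsto_0[OF run steps inf lam]
    have "\<exists>x\<in>{x. 0 \<in> T x}. z \<longlonglongrightarrow> x"
    proof (rule convergent_of_convergent_dist_to_cluster_points[OF assms(2)])
      fix x assume "x \<in> {x. 0 \<in> T x}"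
      hence "convergent (h x)" using conv(2) by blast
      hence "convergent (\<lambda>k. h x (Suc k))" by (simp add: convergent_Suc_iff)
      then obtain L where "(\<lambda>k. h x (Suc k)) \<longlonglongrightarrow> L" by (auto simp: convergent_def)
      from tendsto_real_sqrt[OF this] show "convergent (\<lambda>k. dist (z k) x)"
        by (auto simp: h_def prev_Suc dist_norm convergent_def)
    next
      fix x and r :: "nat \<Rightarrow> nat"
      assume r: "strict_mono r" and x: "(z \<circ> r) \<longlonglongrightarrow> x"
      have "(\<lambda>k. zt (r k) - z (r k)) \<longlonglongrightarrow> 0" "(\<lambda>k. v (r k)) \<longlonglongrightarrow> 0"
        using LIMSEQ_subseq_LIMSEQ[OF res(2) r] LIMSEQ_subseq_LIMSEQ[OF res(1) r]
        by (simp_all add: o_def)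
      moreover from tendsto_add[OF this(1) x] have "(\<lambda>k. zt (r k)) \<longlonglongrightarrow> x" by (simp add: o_def)
      ultimately show "x \<in> {x. 0 \<in> T x}"
        using maximal_monotone_closed_graph[OF assms(1), of "\<lambda>k. v (r k)" "\<lambda>k. zt (r k)"] step(5)
        by simp
    qed
    then obtain x where x: "0 \<in> T x" "z \<longlonglongrightarrow> x" by blast
    with tendsto_add[OF res(2) x(2)] res(1) show ?thesis by auto
  qed
  ultimately show ?thesis by blast
qed

end
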